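(* Let $f$ be a real-valued function of one real variable that is $C^4$ in a neighborhood of a point $x^*\in\mathbb{R}$ with $f'(x^* )=0$ and $f''(x^* )\neq 0$. Let $(x_k)$ be a sequence generated from initial points $x_{-1},x_0$ by $$\beta_k=-\frac{x_k-x_{k-1}}{f'(x_k)-f'(x_{k-1})},\qquad x_{k+1}=x_k-\frac{\beta_k f'(x_k)^2}{f'\bigl(x_k+\beta_k f'(x_k)\bigr)-f'(x_k)},\qquad k=0,1,2,\dots,$$ and write $\varepsilon_k=x_k-x^*$. If $\lim_{k\to\infty}x_k=x^*$, then $$\lim_{k\to\infty}\frac{|\varepsilon_{k+1}|}{|\varepsilon_k^2\,\varepsilon_{k-1}|}=\Bigl(\frac{f'''(x^* )}{2f''(x^* )}\Bigr)^2.$$ In particular, the iteration converges superquadratically with order of convergence $1+\sqrt{2}$.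
   Context: The iteration is assumed to be well defined for all $k$, i.e. all iterates and the points $x_k+\beta_k f'(x_k)$ lie where $f'$ is defined, and all denominators appearing in it are nonzero. The iteration has order of convergence $q$ if there is a constant $c>0$ such that $|\varepsilon_{k+1}|\le c\,|\varepsilon_k|^q$ for all sufficiently large $k$. *)

theory Defs
  imports "HOL-Analysis.Analysis" "HOL-Library.Landau_Symbols"
begin

definition Ck_on :: "nat \<Rightarrow> (real \<Rightarrow> real) \<Rightarrow> real set \<Rightarrow> bool" where
  "Ck_on n f U \<longleftrightarrow>
     (\<forall>i<n. \<forall>y\<in>U. (deriv ^^ i) f differentiable (at y)) \<and> continuous_on U ((deriv ^^ n) f)"

text \<open>
  Sequences are indexed by \<open>int\<close>, so that the initial points are literally
  \<open>x (-1)\<close> and \<open>x 0\<close>; values at indices below \<open>-1\<close> play no role.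
\<close>

definition step_beta :: "(real \<Rightarrow> real) \<Rightarrow> (int \<Rightarrow> real) \<Rightarrow> int \<Rightarrow> real" where
  "step_beta f x k = - (x k - x (k - 1)) / (deriv f (x k) - deriv f (x (k - 1)))"

definition aux_point :: "(real \<Rightarrow> real) \<Rightarrow> (int \<Rightarrow> real) \<Rightarrow> int \<Rightarrow> real" where
  "aux_point f x k = x k + step_beta f x k * deriv f (x k)"

text \<open>
  \<open>deriv\<close> and division are total in HOL, so well-definedness has to be stated separately.
  A function with domain \<open>D\<close> is represented by an arbitrary extension to the whole line;
  "\<open>f'\<close> is defined at \<open>y\<close>" is \<open>f differentiable (at y)\<close>.
\<close>

definition iteration_well_defined :: "(real \<Rightarrow> real) \<Rightarrow> (int \<Rightarrow> real) \<Rightarrow> bool" where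
  "iteration_well_defined f x \<longleftrightarrow>
     (\<forall>k\<ge>-1. f differentiable (at (x k))) \<and>
     (\<forall>k\<ge>0. f differentiable (at (aux_point f x k))) \<and>
     (\<forall>k\<ge>0. deriv f (x k) - deriv f (x (k - 1)) \<noteq> 0) \<and>
     (\<forall>k\<ge>0. deriv f (aux_point f x k) - deriv f (x k) \<noteq> 0)"

definition generated_by_iteration :: "(real \<Rightarrow> real) \<Rightarrow> (int \<Rightarrow> real) \<Rightarrow> bool" where
  "generated_by_iteration f x \<longleftrightarrow>
     (\<forall>k\<ge>0. x (k + 1) =
        x k - step_beta f x k * (deriv f (x k))\<^sup>2 / (deriv f (aux_point f x k) - deriv f (x k)))"

definition order_of_convergence :: "(int \<Rightarrow> real) \<Rightarrow> real \<Rightarrow> real \<Rightarrow> bool" where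
  "order_of_convergence x l q \<longleftrightarrow>
     (\<exists>c>0. \<forall>\<^sub>F k in at_top. \<bar>x (k + 1) - l\<bar> \<le> c * \<bar>x k - l\<bar> powr q)"

definition superquadratic_convergence :: "(int \<Rightarrow> real) \<Rightarrow> real \<Rightarrow> bool" where
  "superquadratic_convergence x l \<longleftrightarrow>
     (x \<longlongrightarrow> l) at_top \<and> (\<lambda>k. x (k + 1) - l) \<in> o[at_top](\<lambda>k. (x k - l)\<^sup>2)"

end

theory Submission
  imports Defs
begin

text \<open>
  One step of the iteration is two secant steps applied to \<open>g = f'\<close>, whose simple zero is
  \<open>x\<^sup>*\<close>. The auxiliary point \<open>y\<^sub>k = x\<^sub>k + \<beta>\<^sub>k g(x\<^sub>k)\<close> is the secant step from
  \<open>x\<^sub>k, x\<^sub>k\<^sub>-\<^sub>1\<close>, and since \<open>\<beta>\<^sub>k g(x\<^sub>k) = y\<^sub>k - x\<^sub>k\<close>, the new iterate is the secant step from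
  \<open>x\<^sub>k, y\<^sub>k\<close>. For a secant step \<open>s\<close> from \<open>u, v\<close> towards a zero \<open>a\<close>, two mean value theorems
  (for the first and the second divided difference) give
  \<open>s - a = (u - a) (v - a) g''(\<xi>) / (2 g'(\<eta>))\<close> with \<open>\<xi>, \<eta>\<close> no farther from \<open>a\<close> than
  the farther of \<open>u, v\<close> (\<open>secant_step_error\<close>). The last factor tends to
  \<open>L = g''(a) / (2 g'(a))\<close>, and applying this twice yields
  \<open>\<epsilon>\<^sub>k\<^sub>+\<^sub>1 = A\<^sub>k R\<^sub>k \<epsilon>\<^sub>k\<^sup>2 \<epsilon>\<^sub>k\<^sub>-\<^sub>1\<close> with \<open>A\<^sub>k, R\<^sub>k \<longlonglongrightarrow> L\<close>. This is the limit claimed,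
  and superquadratic convergence follows because \<open>\<epsilon>\<^sub>k\<^sub>-\<^sub>1\<close> tends to 0.

  For the order \<open>q = 1 + \<surd>2\<close>, the positive root of \<open>q\<^sup>2 = 2 q + 1\<close>, there are two cases.
  If \<open>L \<noteq> 0\<close>, the quantity \<open>d\<^sub>k = ln (|\<epsilon>\<^sub>k\<^sub>+\<^sub>1| / |\<epsilon>\<^sub>k|\<^sup>q)\<close> satisfies
  \<open>d\<^sub>k = - d\<^sub>k\<^sub>-\<^sub>1 / q + ln |A\<^sub>k R\<^sub>k|\<close>. The last term converges, so this is a contraction with
  bounded perturbation and \<open>d\<^sub>k\<close> stays bounded
  (\<open>order_from_quadratic_times_linear_recurrence\<close>). If \<open>L = 0\<close>, the logarithm tends to
  \<open>-\<infinity>\<close> in an uncontrolled way, and the recurrence alone would not give the order. Here the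
  fourth derivative of \<open>f\<close> helps: \<open>g''\<close> vanishes at \<open>x\<^sup>*\<close> and is differentiable there, so
  \<open>R\<^sub>k = O(\<epsilon>\<^sub>k)\<close> (\<open>secant_ratio_linear_bound\<close>). Convergence is then even cubic, and \<open>q < 3\<close>.
\<close>

section \<open>The error of a secant step\<close>

definition secant_step :: "(real \<Rightarrow> real) \<Rightarrow> real \<Rightarrow> real \<Rightarrow> real" where
  "secant_step g u v = u - g u * (u - v) / (g u - g v)"

text \<open>
  Subtracting from \<open>g\<close> the quadratic that interpolates it at \<open>p, q, r\<close> leaves a function with
  three zeros, so by Rolle its second derivative vanishes somewhere. The leading coefficient of the
  quadratic is the second divided difference. The identity is stated without denominators, because
  then both sides change sign under transposition of two nodes.
\<close>

lemma second_divided_difference_mean_value_sorted: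
  fixes g g' g'' :: "real \<Rightarrow> real"
  assumes "p < q" "q < r"
    and g': "\<And>t. t \<in> {p..r} \<Longrightarrow> (g has_real_derivative g' t) (at t)"
    and g'': "\<And>t. t \<in> {p..r} \<Longrightarrow> (g' has_real_derivative g'' t) (at t)"
  shows "\<exists>\<xi>\<in>{p..r}. g p * (r - q) + g q * (p - r) + g r * (q - p)
                    = g'' \<xi> / 2 * ((q - p) * (r - q) * (r - p))"
proof -
  define m where "m = (g q - g p) / (q - p)"
  \<comment> \<open>\<open>g p + m (t - p) + K (t - p) (t - q)\<close> is Newton's form of the interpolating quadratic.\<close>
  define K where
    "K = (g p * (r - q) + g q * (p - r) + g r * (q - p)) / ((q - p) * (r - q) * (r - p))"
  define \<phi> where "\<phi> = (\<lambda>t. g t - g p - m * (t - p) - K * ((t - p) * (t - q)))"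
  have \<phi>p: "\<phi> p = 0" by (simp add: \<phi>_def)
  have \<phi>q: "\<phi> q = 0" using assms(1) by (simp add: \<phi>_def m_def)
  have "K * ((r - p) * (r - q)) = (g p * (r - q) + g q * (p - r) + g r * (q - p)) / (q - p)"
  proof -
    have "N / (A * B * C) * (C * B) = N / A" if "B \<noteq> 0" "C \<noteq> 0" for N A B C :: real
      using that by (simp add: field_simps)
    then show ?thesis
      using assms(1,2) by (simp add: K_def)
  qed
  moreover have "g r - g p - m * (r - p) = (g p * (r - q) + g q * (p - r) + g r * (q - p)) / (q - p)"
    using assms(1) by (simp add: m_def divide_simps) (simp add: algebra_simps)
  ultimately have \<phi>r: "\<phi> r = 0"
    by (simp add: \<phi>_def)
  have d: "(\<phi> has_real_derivative g' t - m - K * (2 * t - p - q)) (at t)" if "t \<in> {p..r}" for t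
    unfolding \<phi>_def by (auto intro!: derivative_eq_intros g' that simp: algebra_simps)
  have dd: "((\<lambda>t. g' t - m - K * (2 * t - p - q)) has_real_derivative g'' t - 2 * K) (at t)"
    if "t \<in> {p..r}" for t
    by (auto intro!: derivative_eq_intros g'' that simp: algebra_simps)
  obtain s where s: "p < s" "s < q" "g' s - m - K * (2 * s - p - q) = 0"
    using MVT2[of p q \<phi> "\<lambda>t. g' t - m - K * (2 * t - p - q)"] d assms(1,2) \<phi>p \<phi>q by auto
  obtain t where t: "q < t" "t < r" "g' t - m - K * (2 * t - p - q) = 0"
    using MVT2[of q r \<phi> "\<lambda>t. g' t - m - K * (2 * t - p - q)"] d assms(1,2) \<phi>q \<phi>r by auto
  obtain \<xi> where \<xi>: "s < \<xi>" "\<xi> < t" "g'' \<xi> - 2 * K = 0"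
    using MVT2[of s t "\<lambda>t. g' t - m - K * (2 * t - p - q)" "\<lambda>t. g'' t - 2 * K"] dd s t by auto
  have "g'' \<xi> / 2 = K" using \<xi>(3) by simp
  then show ?thesis
    using assms(1,2) s(1,2) t(1,2) \<xi>(1,2) by (intro bexI[of _ \<xi>]) (auto simp: K_def)
qed

text \<open>
  Iterates may approach their limit from either side and in any order, so the nodes have to be
  unordered. Antisymmetry in the nodes reduces every order to the sorted one.
\<close>

lemma second_divided_difference_mean_value:
  fixes g g' g'' :: "real \<Rightarrow> real"
  assumes "u \<noteq> v" "v \<noteq> w" "u \<noteq> w" and in_I: "u \<in> {l..h}" "v \<in> {l..h}" "w \<in> {l..h}"
    and g': "\<And>t. t \<in> {l..h} \<Longrightarrow> (g has_real_derivative g' t) (at t)"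
    and g'': "\<And>t. t \<in> {l..h} \<Longrightarrow> (g' has_real_derivative g'' t) (at t)"
  shows "\<exists>\<xi>\<in>{l..h}. g u * (w - v) + g v * (u - w) + g w * (v - u)
                    = g'' \<xi> / 2 * ((v - u) * (w - v) * (w - u))"
proof -
  have sorted: "\<exists>\<xi>\<in>{l..h}. g p * (r - q) + g q * (p - r) + g r * (q - p)
                    = g'' \<xi> / 2 * ((q - p) * (r - q) * (r - p))"
    if "p < q" "q < r" "p \<in> {l..h}" "r \<in> {l..h}" for p q r
  proof -
    have "{p..r} \<subseteq> {l..h}" using that by auto
    then show ?thesis
      using second_divided_difference_mean_value_sorted[OF that(1,2), of g g' g''] g' g''
      by blast
  qed
  consider "u < v" "v < w" | "u < w" "w < v" | "v < u" "u < w"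
    | "v < w" "w < u" | "w < u" "u < v" | "w < v" "v < u"
    using assms(1-3) by linarith
  then show ?thesis
  proof cases
    case 1 then show ?thesis using sorted[of u v w] in_I by blast
  next
    case 2
    then obtain \<xi> where "\<xi> \<in> {l..h}" and eq: "g u * (v - w) + g w * (u - v) + g v * (w - u)
        = g'' \<xi> / 2 * ((w - u) * (v - w) * (v - u))"
      using sorted[of u w v] in_I by blast
    moreover have "g u * (w - v) + g v * (u - w) + g w * (v - u)
        = g'' \<xi> / 2 * ((v - u) * (w - v) * (w - u))"
      using eq by (simp add: algebra_simps)
    ultimately show ?thesis by blast
  next
    case 3
    then obtain \<xi> where "\<xi> \<in> {l..h}" and eq: "g v * (w - u) + g u * (v - w) + g w * (u - v)
        = g'' \<xi> / 2 * ((u - v) * (w - u) * (w - v))"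
      using sorted[of v u w] in_I by blast
    moreover have "g u * (w - v) + g v * (u - w) + g w * (v - u)
        = g'' \<xi> / 2 * ((v - u) * (w - v) * (w - u))"
      using eq by (simp add: algebra_simps)
    ultimately show ?thesis by blast
  next
    case 4
    then obtain \<xi> where "\<xi> \<in> {l..h}" and eq: "g v * (u - w) + g w * (v - u) + g u * (w - v)
        = g'' \<xi> / 2 * ((w - v) * (u - w) * (u - v))"
      using sorted[of v w u] in_I by blast
    moreover have "g u * (w - v) + g v * (u - w) + g w * (v - u)
        = g'' \<xi> / 2 * ((v - u) * (w - v) * (w - u))"
      using eq by (simp add: algebra_simps)
    ultimately show ?thesis by blast
  next
    case 5
    then obtain \<xi> where "\<xi> \<in> {l..h}" and eq: "g w * (v - u) + g u * (w - v) + g v * (u - w)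
        = g'' \<xi> / 2 * ((u - w) * (v - u) * (v - w))"
      using sorted[of w u v] in_I by blast
    moreover have "g u * (w - v) + g v * (u - w) + g w * (v - u)
        = g'' \<xi> / 2 * ((v - u) * (w - v) * (w - u))"
      using eq by (simp add: algebra_simps)
    ultimately show ?thesis by blast
  next
    case 6
    then obtain \<xi> where "\<xi> \<in> {l..h}" and eq: "g w * (u - v) + g v * (w - u) + g u * (v - w)
        = g'' \<xi> / 2 * ((v - w) * (u - v) * (u - w))"
      using sorted[of w v u] in_I by blast
    moreover have "g u * (w - v) + g v * (u - w) + g w * (v - u)
        = g'' \<xi> / 2 * ((v - u) * (w - v) * (w - u))"
      using eq by (simp add: algebra_simps)
    ultimately show ?thesis by blast
  qed
qed

text \<open>
  Multiplied by \<open>g u - g v\<close>, the error of the secant step is minus the numerator of the second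
  divided difference at \<open>u, v, a\<close>, while \<open>g u - g v\<close> itself is given by the ordinary mean
  value theorem. Bounding \<open>\<xi>\<close> and \<open>\<eta>\<close> by the distances of \<open>u\<close> and \<open>v\<close> from
  \<open>a\<close> is what makes the formula useful when both tend to \<open>a\<close>.
\<close>

lemma secant_step_error:
  fixes g g' g'' :: "real \<Rightarrow> real"
  defines "\<rho> \<equiv> \<lambda>u v a :: real. max (\<bar>u - a\<bar>) (\<bar>v - a\<bar>)"
  assumes "u \<noteq> v" "u \<noteq> a" "v \<noteq> a" and zero: "g a = 0"
    and g': "\<And>t. \<bar>t - a\<bar> \<le> \<rho> u v a \<Longrightarrow> (g has_real_derivative g' t) (at t)"
    and g'': "\<And>t. \<bar>t - a\<bar> \<le> \<rho> u v a \<Longrightarrow> (g' has_real_derivative g'' t) (at t)"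
    and nz: "\<And>t. \<bar>t - a\<bar> \<le> \<rho> u v a \<Longrightarrow> g' t \<noteq> 0"
  shows "\<exists>\<xi> \<eta>. \<bar>\<xi> - a\<bar> \<le> \<rho> u v a \<and> \<bar>\<eta> - a\<bar> \<le> \<rho> u v a
           \<and> secant_step g u v - a = (u - a) * (v - a) * (g'' \<xi> / (2 * g' \<eta>))"
proof -
  have I: "t \<in> {a - \<rho> u v a..a + \<rho> u v a} \<longleftrightarrow> \<bar>t - a\<bar> \<le> \<rho> u v a" for t
    by auto
  have in_I: "\<bar>u - a\<bar> \<le> \<rho> u v a" "\<bar>v - a\<bar> \<le> \<rho> u v a" "\<bar>a - a\<bar> \<le> \<rho> u v a"
    by (auto simp: \<rho>_def)
  have "\<exists>\<xi>\<in>{a - \<rho> u v a..a + \<rho> u v a}.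
      g u * (a - v) + g v * (u - a) + g a * (v - u) = g'' \<xi> / 2 * ((v - u) * (a - v) * (a - u))"
    by (rule second_divided_difference_mean_value[where g' = g']; (unfold I)?)
       (fact assms(2) assms(4) assms(3) in_I g' g'')+
  then obtain \<xi> where \<xi>: "\<bar>\<xi> - a\<bar> \<le> \<rho> u v a"
    "g u * (a - v) + g v * (u - a) + g a * (v - u) = g'' \<xi> / 2 * ((v - u) * (a - v) * (a - u))"
    using that I by (elim bexE) blast
  have mvt: "\<exists>\<eta>. \<bar>\<eta> - a\<bar> \<le> \<rho> u v a \<and> g s - g t = (s - t) * g' \<eta>"
    if "t < s" "\<bar>s - a\<bar> \<le> \<rho> u v a" "\<bar>t - a\<bar> \<le> \<rho> u v a" for s t
  proof -
    have "\<bar>z - a\<bar> \<le> \<rho> u v a" if "t \<le> z" "z \<le> s" for z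
      using that \<open>\<bar>s - a\<bar> \<le> \<rho> u v a\<close> \<open>\<bar>t - a\<bar> \<le> \<rho> u v a\<close> by linarith
    then show ?thesis
      using MVT2[OF that(1), of g g'] g' by (meson less_imp_le)
  qed
  obtain \<eta> where \<eta>: "\<bar>\<eta> - a\<bar> \<le> \<rho> u v a" "g u - g v = (u - v) * g' \<eta>"
  proof (cases "u < v")
    case True
    then obtain \<eta> where "\<bar>\<eta> - a\<bar> \<le> \<rho> u v a" "g v - g u = (v - u) * g' \<eta>"
      using mvt in_I by blast
    then show ?thesis by (intro that[of \<eta>]) (auto simp: algebra_simps)
  next
    case False
    then show ?thesis using mvt[of v u] in_I that assms(2) by fastforce
  qed
  have "g' \<eta> \<noteq> 0" using nz \<eta>(1) by blast
  then have ne: "g u - g v \<noteq> 0" using \<eta>(2) assms(2) by simp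
  have "(secant_step g u v - a) * (g u - g v) = (u - a) * (g u - g v) - g u * (u - v)"
    using ne by (simp add: secant_step_def left_diff_distrib)
  also have "\<dots> = - (g u * (a - v) + g v * (u - a) + g a * (v - u))"
    using zero by (simp add: algebra_simps)
  also have "\<dots> = (u - a) * (v - a) * (g'' \<xi> / 2) * (u - v)"
  proof -
    have "- (c * ((v - u) * (a - v) * (a - u))) = (u - a) * (v - a) * c * (u - v)" for c
      by (simp add: algebra_simps)
    then show ?thesis unfolding \<xi>(2) .
  qed
  finally have "(secant_step g u v - a) * g' \<eta> = (u - a) * (v - a) * (g'' \<xi> / 2)"
    using assms(2) unfolding \<eta>(2) by (simp add: mult.assoc)
  then have "secant_step g u v - a = (u - a) * (v - a) * (g'' \<xi> / (2 * g' \<eta>))"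
    using \<open>g' \<eta> \<noteq> 0\<close> by (simp add: field_simps)
  then show ?thesis using \<xi>(1) \<eta>(1) by blast
qed

text \<open>
  The intermediate points are chosen as functions of the index, so that limits can be taken along
  any filter. For \<open>\<xi>\<close> the quantitative bound is kept as well, since a rate is needed when
  \<open>g'' a = 0\<close>.
\<close>

lemma secant_ratio_mean_value:
  fixes g g' g'' :: "real \<Rightarrow> real" and u v :: "'a \<Rightarrow> real"
  assumes "g a = 0" "g' a \<noteq> 0"
    and g': "\<forall>\<^sub>F t in nhds a. (g has_real_derivative g' t) (at t)"
    and g'': "\<forall>\<^sub>F t in nhds a. (g' has_real_derivative g'' t) (at t)"
    and lim: "(u \<longlongrightarrow> a) F" "(v \<longlongrightarrow> a) F"
    and dist: "\<forall>\<^sub>F k in F. u k \<noteq> v k \<and> u k \<noteq> a \<and> v k \<noteq> a"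
  obtains \<xi> \<eta> where "(\<xi> \<longlongrightarrow> a) F" "((\<lambda>k. g' (\<eta> k)) \<longlongrightarrow> g' a) F"
    "\<forall>\<^sub>F k in F. \<bar>\<xi> k - a\<bar> \<le> max (\<bar>u k - a\<bar>) (\<bar>v k - a\<bar>)"
    "\<forall>\<^sub>F k in F. (secant_step g (u k) (v k) - a) / ((u k - a) * (v k - a))
                 = g'' (\<xi> k) / (2 * g' (\<eta> k))"
proof -
  have cont: "isCont g' a"
    using eventually_nhds_x_imp_x[OF g''] by (rule DERIV_isCont)
  then have "\<forall>\<^sub>F t in nhds a. g' t \<noteq> 0"
    using assms(2) by (metis isCont_def tendsto_at_iff_tendsto_nhds tendsto_imp_eventually_ne)
  with g' g'' have "\<forall>\<^sub>F t in nhds a. (g has_real_derivative g' t) (at t)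
      \<and> (g' has_real_derivative g'' t) (at t) \<and> g' t \<noteq> 0"
    by eventually_elim simp
  then obtain d where d: "d > 0"
    "\<And>t. \<bar>t - a\<bar> < d \<Longrightarrow> (g has_real_derivative g' t) (at t)"
    "\<And>t. \<bar>t - a\<bar> < d \<Longrightarrow> (g' has_real_derivative g'' t) (at t)"
    "\<And>t. \<bar>t - a\<bar> < d \<Longrightarrow> g' t \<noteq> 0"
    unfolding eventually_nhds_metric dist_real_def by blast
  have "\<forall>\<^sub>F k in F. \<bar>u k - a\<bar> < d" "\<forall>\<^sub>F k in F. \<bar>v k - a\<bar> < d"
    using lim d(1) by (auto simp: tendsto_iff dist_real_def)
  with dist have "\<forall>\<^sub>F k in F. \<exists>\<xi> \<eta>. \<bar>\<xi> - a\<bar> \<le> max (\<bar>u k - a\<bar>) (\<bar>v k - a\<bar>)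
      \<and> \<bar>\<eta> - a\<bar> \<le> max (\<bar>u k - a\<bar>) (\<bar>v k - a\<bar>)
      \<and> secant_step g (u k) (v k) - a = (u k - a) * (v k - a) * (g'' \<xi> / (2 * g' \<eta>))"
  proof eventually_elim
    case (elim k)
    then show ?case
      by (intro secant_step_error) (use assms(1) d in auto)
  qed
  then obtain \<xi> where "\<forall>\<^sub>F k in F. \<exists>\<eta>. \<bar>\<xi> k - a\<bar> \<le> max (\<bar>u k - a\<bar>) (\<bar>v k - a\<bar>)
      \<and> \<bar>\<eta> - a\<bar> \<le> max (\<bar>u k - a\<bar>) (\<bar>v k - a\<bar>)
      \<and> secant_step g (u k) (v k) - a = (u k - a) * (v k - a) * (g'' (\<xi> k) / (2 * g' \<eta>))"
    by (subst (asm) eventually_ex) (elim exE, rule that)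
  then obtain \<eta> where ev: "\<forall>\<^sub>F k in F. \<bar>\<xi> k - a\<bar> \<le> max (\<bar>u k - a\<bar>) (\<bar>v k - a\<bar>)
      \<and> \<bar>\<eta> k - a\<bar> \<le> max (\<bar>u k - a\<bar>) (\<bar>v k - a\<bar>)
      \<and> secant_step g (u k) (v k) - a = (u k - a) * (v k - a) * (g'' (\<xi> k) / (2 * g' (\<eta> k)))"
    by (subst (asm) eventually_ex) (elim exE, rule that)
  have "((\<lambda>k. max (\<bar>u k - a\<bar>) (\<bar>v k - a\<bar>)) \<longlongrightarrow> max (\<bar>a - a\<bar>) (\<bar>a - a\<bar>)) F"
    by (intro tendsto_intros lim)
  then have max0: "((\<lambda>k. max (\<bar>u k - a\<bar>) (\<bar>v k - a\<bar>)) \<longlongrightarrow> 0) F" by simp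
  have near: "(\<zeta> \<longlongrightarrow> a) F" if "\<forall>\<^sub>F k in F. \<bar>\<zeta> k - a\<bar> \<le> max (\<bar>u k - a\<bar>) (\<bar>v k - a\<bar>)" for \<zeta>
  proof -
    have "((\<lambda>k. \<zeta> k - a) \<longlongrightarrow> 0) F"
      by (rule Lim_null_comparison[OF _ max0]) (use that in simp)
    then show ?thesis by (rule LIM_zero_cancel)
  qed
  show thesis
  proof (rule that[of \<xi> \<eta>])
    show "(\<xi> \<longlongrightarrow> a) F" by (rule near) (use ev in eventually_elim, simp)
    have "(\<eta> \<longlongrightarrow> a) F" by (rule near) (use ev in eventually_elim, simp)
    with cont show "((\<lambda>k. g' (\<eta> k)) \<longlongrightarrow> g' a) F" by (rule isCont_tendsto_compose)
    show "\<forall>\<^sub>F k in F. \<bar>\<xi> k - a\<bar> \<le> max (\<bar>u k - a\<bar>) (\<bar>v k - a\<bar>)"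
      using ev by eventually_elim simp
    show "\<forall>\<^sub>F k in F. (secant_step g (u k) (v k) - a) / ((u k - a) * (v k - a))
                 = g'' (\<xi> k) / (2 * g' (\<eta> k))"
      using ev dist
    proof eventually_elim
      case (elim k)
      then have nz: "(u k - a) * (v k - a) \<noteq> 0" by simp
      have eq: "secant_step g (u k) (v k) - a = (u k - a) * (v k - a) * (g'' (\<xi> k) / (2 * g' (\<eta> k)))"
        using elim(1) by blast
      show ?case unfolding eq by (rule nonzero_mult_div_cancel_left[OF nz])
    qed
  qed
qed

lemma secant_ratio_tendsto:
  fixes g g' g'' :: "real \<Rightarrow> real" and u v :: "'a \<Rightarrow> real"
  assumes "g a = 0" "g' a \<noteq> 0"
    and g': "\<forall>\<^sub>F t in nhds a. (g has_real_derivative g' t) (at t)"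
    and g'': "\<forall>\<^sub>F t in nhds a. (g' has_real_derivative g'' t) (at t)"
    and cont: "isCont g'' a"
    and lim: "(u \<longlongrightarrow> a) F" "(v \<longlongrightarrow> a) F"
    and dist: "\<forall>\<^sub>F k in F. u k \<noteq> v k \<and> u k \<noteq> a \<and> v k \<noteq> a"
  shows "((\<lambda>k. (secant_step g (u k) (v k) - a) / ((u k - a) * (v k - a)))
           \<longlongrightarrow> g'' a / (2 * g' a)) F"
proof -
  obtain \<xi> \<eta> where \<xi>: "(\<xi> \<longlongrightarrow> a) F" and \<eta>: "((\<lambda>k. g' (\<eta> k)) \<longlongrightarrow> g' a) F"
    and "\<forall>\<^sub>F k in F. \<bar>\<xi> k - a\<bar> \<le> max (\<bar>u k - a\<bar>) (\<bar>v k - a\<bar>)"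
    and ev: "\<forall>\<^sub>F k in F. (secant_step g (u k) (v k) - a) / ((u k - a) * (v k - a))
                 = g'' (\<xi> k) / (2 * g' (\<eta> k))"
    by (rule secant_ratio_mean_value[OF assms(1-4) lim dist]) (rule that)
  have "((\<lambda>k. g'' (\<xi> k) / (2 * g' (\<eta> k))) \<longlongrightarrow> g'' a / (2 * g' a)) F"
    by (intro tendsto_divide tendsto_mult tendsto_const \<eta> isCont_tendsto_compose[OF cont \<xi>])
       (use assms(2) in simp)
  then show ?thesis using ev by (simp add: tendsto_cong)
qed

text \<open>
  If \<open>g''\<close> vanishes at \<open>a\<close> and is differentiable there, then \<open>|g'' \<xi>| \<le> K |\<xi> - a|\<close> near
  \<open>a\<close>, which improves the convergence of the ratio to 0 to a linear rate.
\<close>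

lemma secant_ratio_linear_bound:
  fixes g g' g'' :: "real \<Rightarrow> real" and u v :: "'a \<Rightarrow> real"
  assumes "g a = 0" "g' a \<noteq> 0"
    and g': "\<forall>\<^sub>F t in nhds a. (g has_real_derivative g' t) (at t)"
    and g'': "\<forall>\<^sub>F t in nhds a. (g' has_real_derivative g'' t) (at t)"
    and diff: "g'' differentiable (at a)" and "g'' a = 0"
    and lim: "(u \<longlongrightarrow> a) F" "(v \<longlongrightarrow> a) F"
    and dist: "\<forall>\<^sub>F k in F. u k \<noteq> v k \<and> u k \<noteq> a \<and> v k \<noteq> a"
  obtains M where "M > 0"
    "\<forall>\<^sub>F k in F. \<bar>(secant_step g (u k) (v k) - a) / ((u k - a) * (v k - a))\<bar>
                 \<le> M * max (\<bar>u k - a\<bar>) (\<bar>v k - a\<bar>)"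
proof -
  obtain \<xi> \<eta> where \<xi>: "(\<xi> \<longlongrightarrow> a) F" and \<eta>: "((\<lambda>k. g' (\<eta> k)) \<longlongrightarrow> g' a) F"
    and le: "\<forall>\<^sub>F k in F. \<bar>\<xi> k - a\<bar> \<le> max (\<bar>u k - a\<bar>) (\<bar>v k - a\<bar>)"
    and ev: "\<forall>\<^sub>F k in F. (secant_step g (u k) (v k) - a) / ((u k - a) * (v k - a))
                 = g'' (\<xi> k) / (2 * g' (\<eta> k))"
    by (rule secant_ratio_mean_value[OF assms(1-4) lim dist]) (rule that)
  obtain D where "(g'' has_real_derivative D) (at a)"
    using diff real_differentiable_def by blast
  then have "((\<lambda>t. \<bar>(g'' t - g'' a) / (t - a)\<bar>) \<longlongrightarrow> \<bar>D\<bar>) (at a)"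
    unfolding has_field_derivative_iff by (rule tendsto_rabs)
  then have "\<forall>\<^sub>F t in at a. \<bar>(g'' t - g'' a) / (t - a)\<bar> < \<bar>D\<bar> + 1"
    by (rule order_tendstoD) simp
  then have "\<forall>\<^sub>F t in at a. \<bar>g'' t\<bar> \<le> (\<bar>D\<bar> + 1) * \<bar>t - a\<bar>"
    using eventually_neq_at_within[of a]
  proof eventually_elim
    case (elim t)
    then have "\<bar>g'' t\<bar> / \<bar>t - a\<bar> < \<bar>D\<bar> + 1" using assms(6) by (simp add: abs_divide)
    then show ?case using elim(2) by (simp add: pos_divide_less_eq)
  qed
  then have "\<forall>\<^sub>F t in nhds a. \<bar>g'' t\<bar> \<le> (\<bar>D\<bar> + 1) * \<bar>t - a\<bar>"
    using assms(6) by (simp add: eventually_nhds_conv_at)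
  then have D: "\<forall>\<^sub>F k in F. \<bar>g'' (\<xi> k)\<bar> \<le> (\<bar>D\<bar> + 1) * \<bar>\<xi> k - a\<bar>"
    using \<xi> by (rule eventually_compose_filterlim)
  have "\<bar>g' a\<bar> / 2 < \<bar>g' a\<bar>" using assms(2) by simp
  then have G: "\<forall>\<^sub>F k in F. \<bar>g' (\<eta> k)\<bar> > \<bar>g' a\<bar> / 2"
    using order_tendstoD(1)[OF tendsto_rabs[OF \<eta>]] by blast
  show thesis
  proof (rule that[of "(\<bar>D\<bar> + 1) / \<bar>g' a\<bar>"])
    show "(\<bar>D\<bar> + 1) / \<bar>g' a\<bar> > 0" using assms(2) by (simp add: add_nonneg_pos)
    show "\<forall>\<^sub>F k in F. \<bar>(secant_step g (u k) (v k) - a) / ((u k - a) * (v k - a))\<bar>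
                 \<le> (\<bar>D\<bar> + 1) / \<bar>g' a\<bar> * max (\<bar>u k - a\<bar>) (\<bar>v k - a\<bar>)"
      using D G le ev
    proof eventually_elim
      case (elim k)
      have "\<bar>g'' (\<xi> k) / (2 * g' (\<eta> k))\<bar> = \<bar>g'' (\<xi> k)\<bar> / (2 * \<bar>g' (\<eta> k)\<bar>)"
        by (simp add: abs_mult)
      also have "\<dots> \<le> ((\<bar>D\<bar> + 1) * max (\<bar>u k - a\<bar>) (\<bar>v k - a\<bar>)) / \<bar>g' a\<bar>"
      proof (rule frac_le)
        show "\<bar>g'' (\<xi> k)\<bar> \<le> (\<bar>D\<bar> + 1) * max (\<bar>u k - a\<bar>) (\<bar>v k - a\<bar>)"
          by (rule order_trans[OF elim(1) mult_left_mono[OF elim(3)]]) simp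
        then show "0 \<le> (\<bar>D\<bar> + 1) * max (\<bar>u k - a\<bar>) (\<bar>v k - a\<bar>)"
          by (rule order_trans[rotated]) simp
        show "0 < \<bar>g' a\<bar>" using assms(2) by simp
        show "\<bar>g' a\<bar> \<le> 2 * \<bar>g' (\<eta> k)\<bar>" using elim(2) by simp
      qed
      finally show ?case using elim(4) by simp
    qed
  qed
qed

section \<open>Order of convergence from a recurrence for the errors\<close>

lemma eventually_bounded_of_affine_contraction:
  fixes d :: "int \<Rightarrow> real"
  assumes "0 \<le> \<theta>" "\<theta> < 1" and ev: "\<forall>\<^sub>F k in at_top. \<bar>d k\<bar> \<le> \<theta> * \<bar>d (k - 1)\<bar> + B"
  obtains T where "\<forall>\<^sub>F k in at_top. \<bar>d k\<bar> \<le> T"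
proof -
  obtain N where N: "\<And>k. k \<ge> N \<Longrightarrow> \<bar>d k\<bar> \<le> \<theta> * \<bar>d (k - 1)\<bar> + B"
    using ev by (auto simp: eventually_at_top_linorder)
  \<comment> \<open>\<open>B / (1 - \<theta>)\<close> is the fixed point of \<open>t \<mapsto> \<theta> t + B\<close>; every bound
      from it upwards is preserved.\<close>
  define T where "T = max \<bar>d N\<bar> (B / (1 - \<theta>))"
  have "B \<le> (1 - \<theta>) * T"
    using assms(2) by (simp add: T_def max_def field_simps)
  then have T: "\<theta> * T + B \<le> T" by (simp add: algebra_simps)
  have "\<bar>d k\<bar> \<le> T" if "k \<ge> N" for k
    using that
  proof (induction k rule: int_ge_induct)
    case base
    show ?case by (simp add: T_def)
  next
    case (step k)
    then have "\<bar>d (k + 1)\<bar> \<le> \<theta> * \<bar>d k\<bar> + B" using N[of "k + 1"] by simp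
    also have "\<dots> \<le> \<theta> * T + B" using step.IH assms(1) by (simp add: mult_left_mono)
    finally show ?case using T by linarith
  qed
  then show thesis using that by (metis eventually_at_top_linorder)
qed

lemma filterlim_int_pred_at_top: "filterlim (\<lambda>k :: int. k - 1) at_top at_top"
  unfolding filterlim_at_top eventually_at_top_linorder
proof
  fix Z :: int
  show "\<exists>N. \<forall>k\<ge>N. Z \<le> k - 1" by (rule exI[of _ "Z + 1"]) simp
qed

text \<open>
  Passing to logarithms turns the asymptotic recurrence into the linear one with characteristic
  equation \<open>q\<^sup>2 = 2 q + 1\<close>. Its roots are \<open>q = 1 + \<surd>2\<close> and \<open>-1/q\<close>. Removing the dominant mode
  \<open>q\<close> leaves a first-order recurrence with factor \<open>-1/q\<close>, which contracts. Positivity of \<open>C\<close>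
  makes the perturbation, the logarithm of the ratio, bounded.
\<close>

lemma order_from_quadratic_times_linear_recurrence:
  fixes x :: "int \<Rightarrow> real"
  assumes nz: "\<forall>\<^sub>F k in at_top. x k \<noteq> a"
    and lim: "((\<lambda>k. \<bar>x (k + 1) - a\<bar> / \<bar>(x k - a)\<^sup>2 * (x (k - 1) - a)\<bar>) \<longlongrightarrow> C) at_top"
    and "C > 0"
  shows "order_of_convergence x a (1 + sqrt 2)"
proof -
  define q where "q = 1 + sqrt 2"
  have q: "q > 1" "2 - q = - (1 / q)"
  proof -
    show "q > 1" by (simp add: q_def)
    moreover have "(2 - q) * q = - 1" by (simp add: q_def algebra_simps)
    ultimately show "2 - q = - (1 / q)" by (simp add: field_simps)
  qed
  define e where "e = (\<lambda>k. ln \<bar>x k - a\<bar>)"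
  define d where "d = (\<lambda>k. e (k + 1) - q * e k)"
  define r where "r = (\<lambda>k. \<bar>x (k + 1) - a\<bar> / \<bar>(x k - a)\<^sup>2 * (x (k - 1) - a)\<bar>)"
  have nz1: "\<forall>\<^sub>F k in at_top. x (k - 1) \<noteq> a"
    using eventually_compose_filterlim[OF nz filterlim_int_pred_at_top] .
  have "filterlim (\<lambda>k :: int. k + 1) at_top at_top"
    by (rule filterlim_at_top_mono[OF filterlim_ident]) auto
  then have nz2: "\<forall>\<^sub>F k in at_top. x (k + 1) \<noteq> a"
    using eventually_compose_filterlim[OF nz] by blast
  have "((\<lambda>k. \<bar>ln (r k)\<bar>) \<longlongrightarrow> \<bar>ln C\<bar>) at_top"
    using lim assms(3) by (intro tendsto_intros) (auto simp: r_def)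
  then have B: "\<forall>\<^sub>F k in at_top. \<bar>ln (r k)\<bar> < \<bar>ln C\<bar> + 1"
    by (rule order_tendstoD) simp
  have "\<forall>\<^sub>F k in at_top. \<bar>d k\<bar> \<le> (1 / q) * \<bar>d (k - 1)\<bar> + (\<bar>ln C\<bar> + 1)"
    using B nz nz1 nz2
  proof eventually_elim
    case (elim k)
    have "ln (r k) = e (k + 1) - (2 * e k + e (k - 1))"
    proof -
      have "r k = \<bar>x (k + 1) - a\<bar> / (\<bar>x k - a\<bar> * \<bar>x k - a\<bar> * \<bar>x (k - 1) - a\<bar>)"
        by (simp add: r_def abs_mult power2_eq_square)
      then show ?thesis
        using elim(2-4) by (simp add: e_def ln_div ln_mult del: abs_mult_self_eq)
    qed
    then have "d k = (2 - q) * e k + e (k - 1) + ln (r k)"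
      by (simp add: d_def algebra_simps)
    also have "\<dots> = - (1 / q) * d (k - 1) + ln (r k)"
      unfolding q(2) d_def using q(1) by (simp add: field_simps)
    finally have "\<bar>d k\<bar> \<le> \<bar>- (1 / q) * d (k - 1)\<bar> + \<bar>ln (r k)\<bar>" by linarith
    also have "\<bar>- (1 / q) * d (k - 1)\<bar> = (1 / q) * \<bar>d (k - 1)\<bar>"
      using q(1) by (simp add: abs_mult)
    finally show ?case using elim(1) by linarith
  qed
  then obtain T where T: "\<forall>\<^sub>F k in at_top. \<bar>d k\<bar> \<le> T"
    using eventually_bounded_of_affine_contraction[of "1 / q" d "\<bar>ln C\<bar> + 1"] q(1) by auto
  have "\<forall>\<^sub>F k in at_top. \<bar>x (k + 1) - a\<bar> \<le> exp T * \<bar>x k - a\<bar> powr q"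
    using T nz nz2
  proof eventually_elim
    case (elim k)
    have "\<bar>x (k + 1) - a\<bar> = exp (e (k + 1))" using elim by (simp add: e_def)
    also have "\<dots> = exp (d k + q * e k)" by (simp add: d_def)
    also have "\<dots> \<le> exp (T + q * e k)" using elim(1) by simp
    also have "\<dots> = exp T * \<bar>x k - a\<bar> powr q"
      using elim(2) by (simp add: exp_add powr_def e_def)
    finally show ?case .
  qed
  then show ?thesis
    unfolding order_of_convergence_def q_def by (intro exI[of _ "exp T"]) simp
qed

section \<open>The two-step secant iteration\<close>

theorem theorem2p2:
  fixes f :: "real \<Rightarrow> real" and xs :: real and x :: "int \<Rightarrow> real" and U :: "real set"
  assumes "open U" and "xs \<in> U" and "Ck_on 4 f U"
    and "deriv f xs = 0" and "(deriv ^^ 2) f xs \<noteq> 0"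
    and "iteration_well_defined f x" and "generated_by_iteration f x"
    and "(x \<longlongrightarrow> xs) at_top"
  defines "\<epsilon> \<equiv> \<lambda>k. x k - xs"
  shows "((\<lambda>k. \<bar>\<epsilon> (k + 1)\<bar> / \<bar>(\<epsilon> k)\<^sup>2 * \<epsilon> (k - 1)\<bar>) \<longlongrightarrow>
            ((deriv ^^ 3) f xs / (2 * (deriv ^^ 2) f xs))\<^sup>2) at_top
         \<and> superquadratic_convergence x xs
         \<and> order_of_convergence x xs (1 + sqrt 2)"
proof -
  define g g' g'' where "g = deriv f" and "g' = (deriv ^^ 2) f" and "g'' = (deriv ^^ 3) f"
  define y where "y = aux_point f x"
  define L where "L = g'' xs / (2 * g' xs)"
  have U: "\<forall>\<^sub>F t in nhds xs. t \<in> U" using assms(1,2) by (rule eventually_nhds_in_open)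
  have dd: "((deriv ^^ i) f has_real_derivative (deriv ^^ Suc i) f t) (at t)"
    if "t \<in> U" "i < 4" for i t
  proof -
    have "(deriv ^^ i) f differentiable (at t)"
      using assms(3) that by (simp add: Ck_on_def)
    then show ?thesis by (simp add: DERIV_deriv_iff_real_differentiable)
  qed
  have g': "\<forall>\<^sub>F t in nhds xs. (g has_real_derivative g' t) (at t)"
    using U by eventually_elim (use dd[of _ 1] in \<open>simp add: g_def g'_def numeral_2_eq_2\<close>)
  have g'': "\<forall>\<^sub>F t in nhds xs. (g' has_real_derivative g'' t) (at t)"
    using U by eventually_elim (use dd[of _ 2] in \<open>simp add: g'_def g''_def eval_nat_numeral\<close>)
  have g''_diff: "g'' differentiable (at xs)"
    using dd[OF assms(2), of 3] by (auto simp: g''_def real_differentiable_def)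
  then have g''_cont: "isCont g'' xs" by (rule differentiable_imp_continuous_within)
  have base: "g xs = 0" "g' xs \<noteq> 0" using assms(4,5) by (auto simp: g_def g'_def)

  have wd: "g (x k) \<noteq> g (x (k - 1))" "g (y k) \<noteq> g (x k)" if "k \<ge> 0" for k
    using assms(6) that by (auto simp: iteration_well_defined_def g_def y_def)
  have y_eq: "y k = secant_step g (x k) (x (k - 1))" for k
  proof -
    have "p + - c / d * h = p - h * c / d" for p c d h :: real by simp
    then show ?thesis
      unfolding y_def aux_point_def step_beta_def secant_step_def g_def .
  qed
  have x_eq: "x (k + 1) = secant_step g (x k) (y k)" if "k \<ge> 0" for k
  proof -
    have yx: "y k - x k = step_beta f x k * g (x k)" by (simp add: y_def aux_point_def g_def)
    have "x (k + 1) = x k - step_beta f x k * (g (x k))\<^sup>2 / (g (y k) - g (x k))"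
      using assms(7) that by (simp add: generated_by_iteration_def g_def y_def)
    also have "\<dots> = x k - g (x k) * (y k - x k) / (g (y k) - g (x k))"
      by (simp add: yx power2_eq_square mult_ac)
    also have "\<dots> = secant_step g (x k) (y k)"
      unfolding secant_step_def by (metis minus_diff_eq minus_divide_divide mult_minus_right)
    finally show ?thesis .
  qed
  \<comment> \<open>An iterate that hits the zero would equal its auxiliary point, making a denominator vanish.\<close>
  have x_ne: "x k \<noteq> xs" if "k \<ge> 0" for k
    using wd(2)[OF that] base(1) by (auto simp: y_eq secant_step_def)
  \<comment> \<open>If the auxiliary point hits the zero, the secant step from it hits the zero too.\<close>
  have y_ne: "y k \<noteq> xs" if "k \<ge> 0" for k
  proof
    assume "y k = xs"
    moreover have "g (x k) \<noteq> 0" using wd(2)[OF that] base(1) calculation by simp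
    ultimately have "x (k + 1) = xs"
      using x_eq[OF that] base(1) by (simp add: secant_step_def)
    then show False using x_ne[of "k + 1"] that by simp
  qed

  \<comment> \<open>The error ratios of the two secant steps that make up one iteration.\<close>
  define A where "A = (\<lambda>k. (y k - xs) / (\<epsilon> k * \<epsilon> (k - 1)))"
  define R where "R = (\<lambda>k. (x (k + 1) - xs) / (\<epsilon> k * (y k - xs)))"
  have lim1: "((\<lambda>k. x (k - 1)) \<longlongrightarrow> xs) at_top"
    using filterlim_compose[OF assms(8) filterlim_int_pred_at_top] .
  have e0: "(\<epsilon> \<longlongrightarrow> 0) at_top" "((\<lambda>k. \<epsilon> (k - 1)) \<longlongrightarrow> 0) at_top"
    using LIM_zero[OF assms(8)] LIM_zero[OF lim1] by (auto simp: \<epsilon>_def)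
  have dist1: "\<forall>\<^sub>F k in at_top. x k \<noteq> x (k - 1) \<and> x k \<noteq> xs \<and> x (k - 1) \<noteq> xs"
    using eventually_ge_at_top[of 1]
  proof eventually_elim
    case (elim k)
    then show ?case using wd(1)[of k] x_ne[of k] x_ne[of "k - 1"] by auto
  qed
  have A: "(A \<longlongrightarrow> L) at_top"
    using secant_ratio_tendsto[OF base g' g'' g''_cont assms(8) lim1 dist1]
    by (simp add: A_def L_def \<epsilon>_def y_eq)
  have y_fac: "\<forall>\<^sub>F k in at_top. y k - xs = A k * \<epsilon> k * \<epsilon> (k - 1)"
    using dist1 by eventually_elim (simp add: A_def \<epsilon>_def)
  have "((\<lambda>k. A k * \<epsilon> k * \<epsilon> (k - 1)) \<longlongrightarrow> L * 0 * 0) at_top"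
    by (intro tendsto_intros A e0)
  then have "((\<lambda>k. y k - xs) \<longlongrightarrow> 0) at_top"
    unfolding tendsto_cong[OF y_fac] by simp
  then have y_lim: "(y \<longlongrightarrow> xs) at_top" by (rule LIM_zero_cancel)
  have dist2: "\<forall>\<^sub>F k in at_top. x k \<noteq> y k \<and> x k \<noteq> xs \<and> y k \<noteq> xs"
    using eventually_ge_at_top[of 0]
    by eventually_elim (use wd(2) x_ne y_ne in metis)
  have ev0: "\<forall>\<^sub>F k :: int in at_top. 0 \<le> k" by (rule eventually_ge_at_top)
  have R_eq: "\<forall>\<^sub>F k in at_top. (secant_step g (x k) (y k) - xs) / ((x k - xs) * (y k - xs)) = R k"
    using ev0 by eventually_elim (simp add: R_def \<epsilon>_def x_eq)
  have R: "(R \<longlongrightarrow> L) at_top"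
    using secant_ratio_tendsto[OF base g' g'' g''_cont assms(8) y_lim dist2]
    unfolding tendsto_cong[OF R_eq] L_def .
  have step: "\<forall>\<^sub>F k in at_top. \<epsilon> (k + 1) = A k * R k * ((\<epsilon> k)\<^sup>2 * \<epsilon> (k - 1))"
    using y_fac dist2
  proof eventually_elim
    case (elim k)
    have "\<epsilon> (k + 1) = R k * (\<epsilon> k * (y k - xs))"
      using elim(2) by (simp add: R_def \<epsilon>_def)
    then show ?case using elim(1) by (simp add: power2_eq_square mult_ac)
  qed
  have AR: "((\<lambda>k. A k * R k) \<longlongrightarrow> L\<^sup>2) at_top"
    using tendsto_mult[OF A R] by (simp add: power2_eq_square)

  have "((\<lambda>k. \<bar>A k * R k\<bar>) \<longlongrightarrow> \<bar>L\<^sup>2\<bar>) at_top" using AR by (rule tendsto_rabs)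
  moreover have "\<forall>\<^sub>F k in at_top.
      \<bar>A k * R k\<bar> = \<bar>\<epsilon> (k + 1)\<bar> / \<bar>(\<epsilon> k)\<^sup>2 * \<epsilon> (k - 1)\<bar>"
    using step dist1
  proof eventually_elim
    case (elim k)
    then have "(\<epsilon> k)\<^sup>2 * \<epsilon> (k - 1) \<noteq> 0" by (simp add: \<epsilon>_def)
    then show ?case using elim(1) by (simp add: abs_mult)
  qed
  ultimately have ratio: "((\<lambda>k. \<bar>\<epsilon> (k + 1)\<bar> / \<bar>(\<epsilon> k)\<^sup>2 * \<epsilon> (k - 1)\<bar>) \<longlongrightarrow> L\<^sup>2) at_top"
    unfolding abs_power2 by (rule Lim_transform_eventually)

  have "((\<lambda>k. A k * R k * \<epsilon> (k - 1)) \<longlongrightarrow> L\<^sup>2 * 0) at_top"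
    by (intro tendsto_mult AR e0)
  moreover have "\<forall>\<^sub>F k in at_top. A k * R k * \<epsilon> (k - 1) = \<epsilon> (k + 1) / (\<epsilon> k)\<^sup>2"
    using step dist1 by eventually_elim (simp add: \<epsilon>_def)
  ultimately have "((\<lambda>k. \<epsilon> (k + 1) / (\<epsilon> k)\<^sup>2) \<longlongrightarrow> L\<^sup>2 * 0) at_top"
    by (rule Lim_transform_eventually)
  then have "((\<lambda>k. \<epsilon> (k + 1) / (\<epsilon> k)\<^sup>2) \<longlongrightarrow> 0) at_top"
    by simp
  moreover have "\<forall>\<^sub>F k in at_top. (\<epsilon> k)\<^sup>2 \<noteq> 0"
    using dist1 by eventually_elim (simp add: \<epsilon>_def)
  ultimately have "(\<lambda>k. \<epsilon> (k + 1)) \<in> o[at_top](\<lambda>k. (\<epsilon> k)\<^sup>2)"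
    by (intro smalloI_tendsto)
  then have super: "superquadratic_convergence x xs"
    using assms(8) by (simp add: superquadratic_convergence_def \<epsilon>_def)

  have order: "order_of_convergence x xs (1 + sqrt 2)"
  proof (cases "L = 0")
    case False
    show ?thesis
    proof (rule order_from_quadratic_times_linear_recurrence)
      show "\<forall>\<^sub>F k in at_top. x k \<noteq> xs" using dist1 by eventually_elim simp
      show "((\<lambda>k. \<bar>x (k + 1) - xs\<bar> / \<bar>(x k - xs)\<^sup>2 * (x (k - 1) - xs)\<bar>) \<longlongrightarrow> L\<^sup>2) at_top"
        using ratio by (simp add: \<epsilon>_def)
      show "L\<^sup>2 > 0" using False by simp
    qed
  next
    case True
    then have "g'' xs = 0" using base(2) by (simp add: L_def)
    then obtain M where M: "M > 0"
      "\<forall>\<^sub>F k in at_top. \<bar>(secant_step g (x k) (y k) - xs) / ((x k - xs) * (y k - xs))\<bar>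
                 \<le> M * max (\<bar>x k - xs\<bar>) (\<bar>y k - xs\<bar>)"
      using secant_ratio_linear_bound[OF base g' g'' g''_diff _ assms(8) y_lim dist2] by blast
    have "((\<lambda>k. \<bar>A k * \<epsilon> (k - 1)\<bar>) \<longlongrightarrow> \<bar>L * 0\<bar>) at_top" by (intro tendsto_intros A e0)
    then have small: "\<forall>\<^sub>F k in at_top. \<bar>A k * \<epsilon> (k - 1)\<bar> < 1"
      by (rule order_tendstoD) simp
    have "\<forall>\<^sub>F k in at_top. \<bar>\<epsilon> k\<bar> < 1"
      using e0(1) by (auto simp: tendsto_iff)
    then have "\<forall>\<^sub>F k in at_top. \<bar>x (k + 1) - xs\<bar> \<le> M * \<bar>x k - xs\<bar> powr (1 + sqrt 2)"
      using small M(2) R_eq y_fac step dist1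
    proof eventually_elim
      case (elim k)
      \<comment> \<open>Once \<open>|A k \<epsilon> (k - 1)| < 1\<close>, the auxiliary point is closer to the zero than \<open>x k\<close> is,
         so the bound on \<open>R k\<close> is in terms of \<open>\<epsilon> k\<close> alone.\<close>
      have "\<bar>y k - xs\<bar> = \<bar>A k * \<epsilon> (k - 1)\<bar> * \<bar>\<epsilon> k\<bar>" using elim(5) by (simp add: abs_mult)
      also have "\<dots> \<le> \<bar>\<epsilon> k\<bar>" using elim(2) by (simp add: mult_left_le_one_le)
      finally have Rk: "\<bar>R k\<bar> \<le> M * \<bar>\<epsilon> k\<bar>" using elim(3,4) by (simp add: \<epsilon>_def)
      have "\<bar>\<epsilon> (k + 1)\<bar> = \<bar>A k * \<epsilon> (k - 1)\<bar> * (\<bar>R k\<bar> * \<bar>\<epsilon> k\<bar>\<^sup>2)"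
        using elim(6) by (simp add: abs_mult)
      also have "\<dots> \<le> \<bar>R k\<bar> * \<bar>\<epsilon> k\<bar>\<^sup>2" using elim(2) by (intro mult_left_le_one_le) auto
      also have "\<dots> \<le> M * \<bar>\<epsilon> k\<bar> * \<bar>\<epsilon> k\<bar>\<^sup>2" using Rk by (intro mult_right_mono) auto
      also have "\<dots> = M * \<bar>\<epsilon> k\<bar> powr 3"
        using elim(7) by (simp add: \<epsilon>_def power2_eq_square power3_eq_cube)
      also have "\<dots> \<le> M * \<bar>\<epsilon> k\<bar> powr (1 + sqrt 2)"
        using M(1) elim(1,7) sqrt2_less_2
        by (intro mult_left_mono powr_mono') (auto simp: \<epsilon>_def)
      finally show ?case by (simp add: \<epsilon>_def)
    qed
    then show ?thesis
      unfolding order_of_convergence_def using M(1) by blast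
  qed
  show ?thesis
    using ratio super order by (simp add: L_def g'_def g''_def)
qed

end
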